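(* Fix $m\in\mathbb{N}_+$ and let $\vartheta=1/\sqrt{m}$. For any $0<\delta<1$ there is a constant $C>0$ depending only on $\delta$ (for the fixed $\vartheta$) such that for all $y>0$ and all $N\in\mathbb{N}_+$, $$\left|\gamma_\vartheta\left(x\in\Omega:\ L_N(x)<\frac{Ny}{\log(1+\vartheta^2)}\right)-\exp\left(-\frac1y\right)\right|\le C\exp\left(-(\log N)^\delta\right).$$
   Context: $\mathbb{N}_+=\{1,2,3,\ldots\}$. Fix $m\in\mathbb{N}_+$ and let $\vartheta>0$ satisfy $\vartheta^2=1/m$. Define $T_\vartheta:[0,\vartheta]\to[0,\vartheta]$ by $T_\vartheta(0)=0$ and $T_\vartheta(x)=\frac1x-\vartheta\left\lfloor\frac1{x\vartheta}\right\rfloor$ for $x\in(0,\vartheta]$. The digits of the $\vartheta$-expansion of $x\in[0,\vartheta]$ are $b_1(x)=\left\lfloor\frac1{x\vartheta}\right\rfloor$ if $x\ne0$, $b_1(0)=\infty$, and $b_n(x)=b_1(T_\vartheta^{n-1}(x))$ for $n\ge2$. $\Omega=(0,\vartheta)\setminus\mathbb{Q}$. For $N\in\mathbb{N}_+$, $L_N(x)=\max_{1\le n\le N}b_n(x)$. $\gamma_\vartheta$ is the ($T_\vartheta$-invariant) Borel probability measure on $[0,\vartheta]$ given by $\mathrm{d}\gamma_\vartheta=\frac1{\log(1+\vartheta^2)}\frac{\vartheta\,\mathrm{d}x}{1+\vartheta x}$. *)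

theory Defs
  imports "HOL-Probability.Probability"
begin

(* Everything is parametrised by \<theta>; the maps are total on the reals, but only
   their values on {0..\<theta>} matter. *)

definition theta_map :: "real \<Rightarrow> real \<Rightarrow> real" where
  "theta_map \<theta> x = (if x = 0 then 0 else 1 / x - \<theta> * of_int \<lfloor>1 / (x * \<theta>)\<rfloor>)"

(* The value \<infinity> really occurs on theta_Omega: for \<theta> = 1 / sqrt m irrational, Omega contains
   (countably many) points with a finite expansion, e.g. 1 / (k * \<theta>), k > m. For 0 < x \<le> \<theta>
   the floor is positive, so nat loses nothing. *)
definition theta_first_digit :: "real \<Rightarrow> real \<Rightarrow> enat" where
  "theta_first_digit \<theta> x = (if x = 0 then \<infinity> else enat (nat \<lfloor>1 / (x * \<theta>)\<rfloor>))"

(* Digits are indexed from 1. *)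
definition theta_digit :: "real \<Rightarrow> nat \<Rightarrow> real \<Rightarrow> enat" where
  "theta_digit \<theta> n x = theta_first_digit \<theta> ((theta_map \<theta> ^^ (n - 1)) x)"

definition theta_max_digit :: "real \<Rightarrow> nat \<Rightarrow> real \<Rightarrow> enat" where
  "theta_max_digit \<theta> N x = Max ((\<lambda>n. theta_digit \<theta> n x) ` {1..N})"

definition theta_Omega :: "real \<Rightarrow> real set" where
  "theta_Omega \<theta> = {0<..<\<theta>} - \<rat>"

definition theta_gauss_measure :: "real \<Rightarrow> real measure" where
  "theta_gauss_measure \<theta> =
     density (restrict_space lborel {0..\<theta>})
       (\<lambda>x. ennreal (1 / ln (1 + \<theta>\<^sup>2) * (\<theta> / (1 + \<theta> * x))))"

end

theory Submission
  imports Defs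
begin

text \<open>
  The idea is to follow, for an integer threshold \<open>w\<close>, the part of \<open>\<gamma>\<^sub>\<theta>\<close> carried by the points
  whose first \<open>n\<close> digits are all below \<open>w\<close>, pushed forward by \<open>T\<^sup>n\<close>. Its density with respect to
  \<open>\<gamma>\<^sub>\<theta>\<close> is \<open>surv w n = L\<^sub>w\<^sup>n 1\<close>, where \<open>L\<^sub>w f x = (\<Sum>k=m..<w. P\<^sub>k(x) f(1 / (k\<theta> + x)))\<close> is the
  Gauss--Kuzmin transfer operator from which the branches \<open>k \<ge> w\<close> have been removed. The distribution
  function \<open>mass w n\<close> of this part obeys the Gauss--Kuzmin recursion, so that densities enter only
  through the derivative of \<open>mass w n\<close>.

  The heart of the proof is that \<open>surv w n\<close> is constant up to a relative error \<open>O(1/w)\<close>, uniformly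
  in \<open>n\<close> (\<open>surv_flat\<close>). The full transfer operator maps increasing functions to decreasing ones and
  contracts their total variation by the factor \<open>1 / (m+1) \<le> 1/2\<close> (\<open>capped_antimono\<close>, \<open>capped_drop\<close>).
  Removing the branches \<open>k \<ge> w\<close> adds only a variation of order \<open>1/w\<close> times the size of the
  function (\<open>osc_le_killed\<close>). Since \<open>L\<^sub>w\<close> hardly decreases the size when \<open>w\<close> is large, the relative
  oscillation stays \<open>O(1/w)\<close>.

  One more digit therefore removes the fraction \<open>p (1 + O(1/w))\<close> of the remaining mass, where
  \<open>p = ln (1 + 1/w) / ln (1 + \<theta>\<^sup>2)\<close> is the measure of \<open>b\<^sub>1 \<ge> w\<close> (\<open>mass_step\<close>), and
  \<open>\<gamma>\<^sub>\<theta>(L\<^sub>N < w) = (1 - p (1 + O(1/w)))\<^sup>N\<close>. With \<open>w\<close> the ceiling of \<open>N y / ln (1 + \<theta>\<^sup>2)\<close> this is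
  \<open>exp(-t + O(t\<^sup>2/N))\<close>, \<open>t = 1/y\<close>, and the factor \<open>t\<^sup>2 exp(-t/2)\<close> is bounded. For bounded \<open>w\<close> both
  quantities compared are exponentially small in \<open>N\<close>. The outcome is an error of at most \<open>136 / N\<close>
  for all \<open>y\<close> (\<open>mass_frechet_limit\<close>), which is stronger than the stated one.
\<close>

section \<open>Elementary inequalities\<close>

text \<open>
  Stochastic dominance by summation by parts: \<open>t\<close> and \<open>t'\<close> are the tails of two distributions, cut off
  at \<open>w\<close>, and the dominating one gives the smaller mean to a decreasing \<open>a\<close>.
\<close>
lemma abel_tail_mono:
  fixes t t' a :: "nat \<Rightarrow> real"
  assumes "m \<le> w" "t m = t' m"
    and "\<And>k. m \<le> k \<Longrightarrow> k \<le> w \<Longrightarrow> t k \<le> t' k"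
    and "\<And>k. m \<le> k \<Longrightarrow> k < w \<Longrightarrow> a (Suc k) \<le> a k"
  shows "(\<Sum>k=m..<w. (t' k - t' (Suc k)) * a k) + t' w * a w
       \<le> (\<Sum>k=m..<w. (t k - t (Suc k)) * a k) + t w * a w"
  using assms
proof (induction w rule: dec_induct)
  case base
  then show ?case by simp
next
  case (step w)
  have "t' (Suc w) * (a (Suc w) - a w) \<le> t (Suc w) * (a (Suc w) - a w)"
    by (rule mult_right_mono_neg) (use step in auto)
  moreover have "(\<Sum>k=m..<w. (t' k - t' (Suc k)) * a k) + t' w * a w
       \<le> (\<Sum>k=m..<w. (t k - t (Suc k)) * a k) + t w * a w"
    using step by auto
  ultimately show ?case using step(1) by (simp add: algebra_simps)
qed

lemma square_exp_bound:
  fixes t :: real assumes "t \<ge> 0" shows "t\<^sup>2 * exp (- (t / 2)) \<le> 8"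
proof -
  have "1 + t / 2 + (t / 2)\<^sup>2 / 2 \<le> exp (t / 2)" using assms by (intro exp_lower_Taylor_quadratic) simp
  then have "t\<^sup>2 / 8 \<le> exp (t / 2)" using assms by (simp add: power2_eq_square)
  then show ?thesis by (simp add: exp_minus field_simps)
qed

text \<open>
  Half of the exponent \<open>t\<close> absorbs the error \<open>exp x\<close>; the other half remains as the decaying factor.
\<close>
lemma exp_gap:
  fixes a t x :: real
  assumes "exp (- t - x) \<le> a" "a \<le> exp (- t + x)" "0 \<le> x" "x \<le> t / 2"
  shows "\<bar>a - exp (- t)\<bar> \<le> x * exp (- (t / 2))"
proof -
  have up: "exp (- t + x) - exp (- t) \<le> x * exp (- (t / 2))"
  proof -
    have "1 - x \<le> exp (- x)" using exp_ge_add_one_self[of "- x"] by simp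
    then have "exp (- t + x) * (1 - x) \<le> exp (- t + x) * exp (- x)" by (intro mult_left_mono) auto
    also have "\<dots> = exp (- t)" by (simp flip: exp_add)
    finally have "exp (- t + x) - exp (- t) \<le> x * exp (- t + x)" by (simp add: algebra_simps)
    also have "\<dots> \<le> x * exp (- (t / 2))" using assms by (intro mult_left_mono) auto
    finally show ?thesis .
  qed
  have "exp (- t) * (1 - x) \<le> exp (- t) * exp (- x)"
    using exp_ge_add_one_self[of "- x"] by (intro mult_left_mono) auto
  then have "exp (- t) * (1 - x) \<le> exp (- t - x)" by (simp flip: exp_add)
  then have "exp (- t) - exp (- t - x) \<le> x * exp (- t)" by (simp add: algebra_simps)
  also have "\<dots> \<le> x * exp (- (t / 2))" using assms by (intro mult_left_mono) auto
  finally show ?thesis using up assms(1,2) by linarith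
qed

lemma exp_neg_le_inverse: fixes x :: real assumes "x > 0" shows "exp (- x) \<le> 1 / x"
proof -
  have "x \<le> exp x" using exp_ge_add_one_self[of x] by linarith
  then show ?thesis using assms by (simp add: exp_minus field_simps)
qed

text \<open>
  The function \<open>exp(-(ln N)\<^sup>d)\<close> with \<open>d < 1\<close> decays more slowly than any power of \<open>N\<close>.
\<close>
lemma inverse_le_subexp:
  assumes "N \<ge> (1::nat)" "0 < d" "d < 1"
  shows "1 / real N \<le> exp 1 * exp (- (ln (real N) powr d))"
proof -
  have "ln (real N) powr d \<le> 1 + ln (real N)"
  proof (cases "ln (real N) \<le> 1")
    case True
    have "ln (real N) powr d \<le> 1 powr d" using True assms by (intro powr_mono2) auto
    moreover have "0 \<le> ln (real N)" using assms(1) by simp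
    ultimately show ?thesis by simp
  next
    case False
    then have "ln (real N) powr d \<le> ln (real N) powr 1" using assms by (intro powr_mono) auto
    then show ?thesis using False by simp
  qed
  then have "exp (- ln (real N)) \<le> exp (1 - ln (real N) powr d)" by simp
  then show ?thesis using assms by (simp add: exp_minus exp_diff inverse_eq_divide)
qed

section \<open>The transition kernel of the digit process\<close>

locale theta_expansion =
  fixes m :: nat and \<theta> :: real
  assumes m_pos: "m \<ge> 1" and theta_eq: "\<theta> = 1 / sqrt (real m)"
begin

lemma theta_pos: "\<theta> > 0" using m_pos by (simp add: theta_eq)

lemma theta_sq: "\<theta> * \<theta> = 1 / real m"
  by (simp add: theta_eq)

lemma theta_sq2: "\<theta>\<^sup>2 = 1 / real m"
  by (simp add: theta_sq power2_eq_square)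

lemma theta_sq_m: "real m * (\<theta> * \<theta>) = 1"
  using m_pos by (simp add: theta_sq)

text \<open>
  The inverse branch of the map on the points with first digit \<open>k\<close>.
\<close>
definition branch :: "nat \<Rightarrow> real \<Rightarrow> real" where
  "branch k x = 1 / (real k * \<theta> + x)"

text \<open>
  If the shifted point \<open>T u\<close> of a \<open>\<gamma>\<^sub>\<theta>\<close>-random \<open>u\<close> is \<open>x\<close>, the first digit of \<open>u\<close> is \<open>k\<close> with
  probability \<open>trans_prob k x\<close>, and at least \<open>k\<close> with probability \<open>tail_prob k x\<close>.
\<close>
definition tail_prob :: "nat \<Rightarrow> real \<Rightarrow> real" where
  "tail_prob k x = (1 + \<theta> * x) / (\<theta> * (real k * \<theta> + x))"

definition trans_prob :: "nat \<Rightarrow> real \<Rightarrow> real" where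
  "trans_prob k x = (1 + \<theta> * x) / ((real k * \<theta> + x) * (real (Suc k) * \<theta> + x))"

text \<open>
  The transfer operator with respect to \<open>\<gamma>\<^sub>\<theta>\<close>, restricted to the digits below \<open>w\<close>.
\<close>
definition killed :: "nat \<Rightarrow> (real \<Rightarrow> real) \<Rightarrow> real \<Rightarrow> real" where
  "killed w f x = (\<Sum>k=m..<w. trans_prob k x * f (branch k x))"

lemma denom_pos: "k \<ge> m \<Longrightarrow> 0 \<le> x \<Longrightarrow> real k * \<theta> + x > 0"
  using theta_pos m_pos by (simp add: add_pos_nonneg)

lemma trans_prob_nonneg: "k \<ge> m \<Longrightarrow> 0 \<le> x \<Longrightarrow> trans_prob k x \<ge> 0"
  using denom_pos[of k x] denom_pos[of "Suc k" x] theta_pos 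
  unfolding trans_prob_def by (auto intro!: divide_nonneg_pos mult_pos_pos add_nonneg_nonneg)

lemma trans_prob_eq:
  assumes "k \<ge> m" "0 \<le> x"
  shows "trans_prob k x = tail_prob k x - tail_prob (Suc k) x"
proof -
  define p q where "p = real k * \<theta> + x" and "q = real (Suc k) * \<theta> + x"
  have "p \<noteq> 0" "q \<noteq> 0" "\<theta> \<noteq> 0"
    using denom_pos[of k x] denom_pos[of "Suc k" x] theta_pos assms by (auto simp: p_def q_def)
  moreover have "\<theta> = q - p" by (simp add: p_def q_def algebra_simps)
  ultimately have "1 / (p * q) = 1 / (\<theta> * p) - 1 / (\<theta> * q)"
    by (simp add: divide_simps)
  then have "(1 + \<theta> * x) * (1 / (p * q)) = (1 + \<theta> * x) * (1 / (\<theta> * p) - 1 / (\<theta> * q))"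
    by simp
  then show ?thesis unfolding trans_prob_def tail_prob_def p_def[symmetric] q_def[symmetric]
    by (simp add: right_diff_distrib)
qed

lemma tail_prob_m: "0 \<le> x \<Longrightarrow> tail_prob m x = 1"
proof -
  assume "0 \<le> x"
  moreover have "1 + \<theta> * x = \<theta> * (real m * \<theta> + x)"
    using theta_sq_m by (simp add: algebra_simps)
  ultimately show ?thesis using denom_pos[of m x] theta_pos unfolding tail_prob_def by simp
qed

text \<open>
  The next digit grows stochastically with \<open>x\<close>. This is where \<open>k \<theta>\<^sup>2 \<ge> m \<theta>\<^sup>2 = 1\<close> enters; it is the
  sign that makes the transfer operator reverse monotonicity.
\<close>
lemma tail_prob_mono:
  assumes "k \<ge> m" "0 \<le> x" "x \<le> y"
  shows "tail_prob k x \<le> tail_prob k y"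
proof -
  have km: "real k * (\<theta> * \<theta>) \<ge> 1"
    using assms(1) theta_sq_m theta_pos mult_right_mono[of "real m" "real k" "\<theta> * \<theta>"] by simp
  have p: "\<theta> * (real k * \<theta> + x) > 0" "\<theta> * (real k * \<theta> + y) > 0"
    using denom_pos[of k x] denom_pos[of k y] theta_pos assms by auto
  have "(real k * (\<theta> * \<theta>) - 1) * (y - x) \<ge> 0" using km assms by simp
  then have "\<theta> * ((real k * (\<theta> * \<theta>) - 1) * (y - x)) \<ge> 0" using theta_pos by simp
  then have "(1 + \<theta> * x) * (\<theta> * (real k * \<theta> + y)) \<le> (1 + \<theta> * y) * (\<theta> * (real k * \<theta> + x))"
    by (simp add: algebra_simps)
  then show ?thesis unfolding tail_prob_def using p
    by (simp only: divide_le_eq pos_le_divide_eq times_divide_eq_left frac_le_eq) (simp add: field_simps)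
qed

lemma tail_prob_0: "tail_prob k 0 = real m / real k"
proof -
  have "\<theta> * (real k * \<theta> + 0) = real k * (1 / real m)" by (simp flip: theta_sq)
  then show ?thesis unfolding tail_prob_def by simp
qed

lemma tail_prob_theta: "tail_prob k \<theta> = (real m + 1) / (real k + 1)"
proof -
  have "\<theta> * (real k * \<theta> + \<theta>) = (real k + 1) * (1 / real m)"
    by (simp add: algebra_simps flip: theta_sq)
  then have "tail_prob k \<theta> = (1 + 1 / real m) / ((real k + 1) * (1 / real m))"
    unfolding tail_prob_def by (simp add: theta_sq)
  then show ?thesis using m_pos by (simp add: divide_simps)
qed

lemma sum_trans_prob:
  assumes "m \<le> w" "0 \<le> x"
  shows "(\<Sum>k=m..<w. trans_prob k x) = 1 - tail_prob w x"
  using assms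
proof (induction w rule: dec_induct)
  case base
  then show ?case by (simp add: tail_prob_m)
next
  case (step w)
  then show ?case by (simp add: trans_prob_eq)
qed

lemma branch_pos: "k \<ge> m \<Longrightarrow> 0 \<le> x \<Longrightarrow> branch k x > 0"
  using denom_pos[of k x] by (simp add: branch_def)

lemma branch_m_0: "branch m 0 = \<theta>"
proof -
  have "real m * \<theta> * \<theta> = 1" using theta_sq_m by (simp only: mult.assoc)
  moreover have "real m * \<theta> \<noteq> 0" using m_pos theta_pos by simp
  ultimately show ?thesis unfolding branch_def by (metis add.right_neutral nonzero_eq_divide_eq mult.commute)
qed

lemma branch_antimono:
  assumes "m \<le> k" "0 \<le> x" "x \<le> y"
  shows "branch k y \<le> branch k x"
  unfolding branch_def using denom_pos[of k x] assms by (intro divide_left_mono mult_pos_pos) auto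

lemma branch_antimono_index:
  assumes "m \<le> k" "k < l" "0 \<le> x" "x \<le> \<theta>" "0 \<le> y"
  shows "branch l y \<le> branch k x"
proof -
  have "real (Suc k) * \<theta> \<le> real l * \<theta>" using assms theta_pos by (intro mult_right_mono) auto
  then have "real k * \<theta> + x \<le> real l * \<theta> + y" using assms by (simp add: algebra_simps)
  then show ?thesis
  unfolding branch_def using denom_pos[of k x] denom_pos[of l y] assms 
    by (intro divide_left_mono mult_pos_pos) auto
qed

lemma branch_theta: "branch k \<theta> = branch (Suc k) 0"
  by (simp add: branch_def algebra_simps)

lemma branch_le: assumes "m \<le> k" "0 \<le> x" shows "branch k x \<le> \<theta>"
proof -
  have "real m * \<theta> \<le> real k * \<theta>" using assms theta_pos by (intro mult_right_mono) auto
  then have "branch k x \<le> branch m 0"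
    unfolding branch_def using denom_pos[of m 0] denom_pos[of k x] assms
    by (intro divide_left_mono mult_pos_pos) auto
  then show ?thesis by (simp add: branch_m_0)
qed

lemma branch_in: "m \<le> k \<Longrightarrow> 0 \<le> x \<Longrightarrow> branch k x \<in> {0..\<theta>}"
  using branch_le[of k x] branch_pos[of k x] by auto

section \<open>Contraction of the oscillation\<close>

text \<open>
  The full transfer operator applied to \<open>A\<close> made constant below \<open>branch w 0\<close>: on the digits \<open>k \<ge> w\<close>
  the function keeps its value at that point, so the infinitely many removed branches
  contribute one explicit term. Unlike \<open>killed w\<close>, this operator is monotonicity-reversing.
\<close>
definition capped :: "nat \<Rightarrow> (real \<Rightarrow> real) \<Rightarrow> real \<Rightarrow> real" where
  "capped w A x = killed w A x + tail_prob w x * A (branch w 0)"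

text \<open>
  Increasing \<open>x\<close> decreases every \<open>branch k x\<close>, and moves the weight towards larger digits, that is,
  towards smaller arguments of \<open>A\<close>; both effects lower the value.
\<close>
lemma capped_antimono:
  assumes A: "mono_on {0..\<theta>} A" and "m \<le> w" "0 \<le> x" "x \<le> y" "y \<le> \<theta>"
  shows "capped w A y \<le> capped w A x"
proof -
  define a where "a k = (if k < w then A (branch k x) else A (branch w 0))" for k
  have 1: "killed w A y \<le> (\<Sum>k=m..<w. trans_prob k y * a k)"
    unfolding killed_def
    by (intro sum_mono mult_left_mono)
       (use assms in \<open>auto simp: a_def intro!: trans_prob_nonneg mono_onD[OF A] branch_antimono branch_le less_imp_le[OF branch_pos]\<close>)
  have "(\<Sum>k=m..<w. (tail_prob k y - tail_prob (Suc k) y) * a k) + tail_prob w y * a w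
     \<le> (\<Sum>k=m..<w. (tail_prob k x - tail_prob (Suc k) x) * a k) + tail_prob w x * a w"
    by (rule abel_tail_mono)
       (use assms in \<open>auto simp: a_def tail_prob_m intro!: tail_prob_mono mono_onD[OF A] branch_antimono_index branch_le less_imp_le[OF branch_pos]\<close>)
  moreover have "(\<Sum>k=m..<w. (tail_prob k z - tail_prob (Suc k) z) * a k) = (\<Sum>k=m..<w. trans_prob k z * a k)"
    if "z \<ge> 0" for z
    using that by (intro sum.cong) (auto simp: trans_prob_eq)
  ultimately have "(\<Sum>k=m..<w. trans_prob k y * a k) + tail_prob w y * a w
     \<le> (\<Sum>k=m..<w. trans_prob k x * a k) + tail_prob w x * a w"
    using assms by simp
  moreover have "(\<Sum>k=m..<w. trans_prob k x * a k) = killed w A x"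
    unfolding killed_def by (intro sum.cong) (auto simp: a_def)
  ultimately show ?thesis using 1 by (simp add: capped_def a_def)
qed

text \<open>
  The points \<open>branch k \<theta>\<close> and \<open>branch (Suc k) 0\<close> coincide, so both end values are combinations of the
  same values \<open>a k = A (branch k 0)\<close>. Comparing the weights shows that the drop is a sum
  of terms \<open>(a k - a (Suc k)) / (k + 1)\<close>, each at most the increment divided by \<open>m + 1\<close>.
\<close>
lemma capped_drop:
  assumes A: "mono_on {0..\<theta>} A" and "m \<le> w"
  shows "capped w A 0 - capped w A \<theta> \<le> (A \<theta> - A 0) / (real m + 1)"
proof -
  define a where "a k = A (branch k 0)" for k
  have tp: "0 \<le> \<theta>" using theta_pos by simp
  have "capped w A 0 - capped w A \<theta> \<le> (a m - a w) / (real m + 1)" using assms(2)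
  proof (induction w rule: dec_induct)
    case base
    then show ?case by (simp add: capped_def killed_def tail_prob_m tp)
  next
    case (step w)
    have dec: "a (Suc w) \<le> a w" unfolding a_def
      by (rule mono_onD[OF A]; (rule branch_in branch_antimono_index)?) (use step(1) tp in auto)
    have st: "capped (Suc w) A x - capped w A x
       = trans_prob w x * A (branch w x) + tail_prob (Suc w) x * a (Suc w) - tail_prob w x * a w" for x
      using step(1) by (simp add: capped_def killed_def a_def)
    have t0: "trans_prob w 0 = tail_prob w 0 - real m / (real w + 1)"
      using step(1) trans_prob_eq[of w 0] tail_prob_0[of "Suc w"] by (simp add: add.commute)
    have tt: "tail_prob (Suc w) \<theta> = (real m + 1) / (real w + 1) - trans_prob w \<theta>"
      using step(1) trans_prob_eq[of w \<theta>] tail_prob_theta[of w] tp by simp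
    have "capped (Suc w) A 0 - capped w A 0 = real m / (real w + 1) * (a (Suc w) - a w)"
    proof -
      have "capped (Suc w) A 0 - capped w A 0 = trans_prob w 0 * a w
          + tail_prob (Suc w) 0 * a (Suc w) - tail_prob w 0 * a w"
        unfolding st by (simp add: a_def)
      also have "tail_prob (Suc w) 0 = real m / (real w + 1)"
        using tail_prob_0[of "Suc w"] by (simp add: add.commute)
      finally show ?thesis unfolding t0 by (simp only: right_diff_distrib left_diff_distrib)
    qed
    moreover have "capped (Suc w) A \<theta> - capped w A \<theta> = (real m + 1) / (real w + 1) * (a (Suc w) - a w)"
    proof -
      have "capped (Suc w) A \<theta> - capped w A \<theta> = trans_prob w \<theta> * a (Suc w)
          + tail_prob (Suc w) \<theta> * a (Suc w) - tail_prob w \<theta> * a w"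
        unfolding st by (simp add: a_def branch_theta)
      also have "tail_prob w \<theta> = (real m + 1) / (real w + 1)" by (rule tail_prob_theta)
      finally show ?thesis unfolding tt by (simp only: right_diff_distrib left_diff_distrib)
    qed
    moreover have "real m / (real w + 1) * (a (Suc w) - a w) - (real m + 1) / (real w + 1) * (a (Suc w) - a w)
       = (a w - a (Suc w)) / (real w + 1)"
      by (simp add: left_diff_distrib right_diff_distrib add_divide_distrib diff_divide_distrib distrib_right)
    moreover have "(a w - a (Suc w)) / (real w + 1) \<le> (a w - a (Suc w)) / (real m + 1)"
      using dec step(1) by (intro divide_left_mono) auto
    moreover have "(a m - a (Suc w)) / (real m + 1)
        = (a m - a w) / (real m + 1) + (a w - a (Suc w)) / (real m + 1)"
      by (simp flip: add_divide_distrib)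
    ultimately show ?case using step.IH by linarith
  qed
  also have "a m = A \<theta>" by (simp add: a_def branch_m_0)
  also have "(A \<theta> - a w) / (real m + 1) \<le> (A \<theta> - A 0) / (real m + 1)"
  proof -
    have "A 0 \<le> a w" unfolding a_def
      by (intro mono_onD[OF A]) (use assms tp in \<open>auto intro!: branch_le less_imp_le[OF branch_pos]\<close>)
    then show ?thesis by (simp add: divide_right_mono)
  qed
  finally show ?thesis .
qed

text \<open>
  A bound on the total variation, expressed by a Jordan decomposition.
\<close>
definition osc_le :: "(real \<Rightarrow> real) \<Rightarrow> real \<Rightarrow> bool" where
  "osc_le f v \<longleftrightarrow> (\<exists>A B. mono_on {0..\<theta>} A \<and> mono_on {0..\<theta>} B \<and>
     (\<forall>x\<in>{0..\<theta>}. f x = A x - B x) \<and> (A \<theta> - A 0) + (B \<theta> - B 0) \<le> v)"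

lemma osc_le_diff:
  assumes "osc_le f v" "x \<in> {0..\<theta>}"
  shows "\<bar>f x - f 0\<bar> \<le> v"
proof -
  obtain A B where A: "mono_on {0..\<theta>} A" and B: "mono_on {0..\<theta>} B"
    and f: "\<And>x. x \<in> {0..\<theta>} \<Longrightarrow> f x = A x - B x" and v: "(A \<theta> - A 0) + (B \<theta> - B 0) \<le> v"
    using assms(1) unfolding osc_le_def by blast
  have "A 0 \<le> A x" "A x \<le> A \<theta>" "B 0 \<le> B x" "B x \<le> B \<theta>"
    using assms(2) by (auto intro!: mono_onD[OF A] mono_onD[OF B])
  then show ?thesis using f[of x] f[of 0] assms(2) v by auto
qed

text \<open>
  Write \<open>killed w f\<close> as \<open>capped w A - capped w B - tail_prob w \<cdot> f (branch w 0)\<close> for a Jordan decomposition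
  \<open>f = A - B\<close>. The first two terms have contracted variation, and \<open>tail_prob w\<close> has variation at
  most \<open>1/w\<close>. Splitting off the constant value at \<open>branch w 0\<close> matters: the function obtained from \<open>f\<close>
  by replacing it by \<open>0\<close> below that point has a jump of height \<open>f (branch w 0)\<close>, without the factor
  \<open>1/w\<close>.
\<close>
lemma osc_le_killed:
  assumes "osc_le f v" "m \<le> w" "f (branch w 0) \<ge> 0"
  shows "osc_le (killed w f) (v / 2 + f (branch w 0) / real w)"
proof -
  obtain A B where A: "mono_on {0..\<theta>} A" and B: "mono_on {0..\<theta>} B"
    and f: "\<And>x. x \<in> {0..\<theta>} \<Longrightarrow> f x = A x - B x" and v: "(A \<theta> - A 0) + (B \<theta> - B 0) \<le> v"
    using assms(1) unfolding osc_le_def by blast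
  have tp: "0 \<le> \<theta>" using theta_pos by simp
  let ?c = "branch w 0"
  let ?A = "\<lambda>x. - capped w B x"
  let ?B = "\<lambda>x. - capped w A x + tail_prob w x * f ?c"
  have m1: "mono_on {0..\<theta>} ?A"
    by (intro mono_onI) (use assms in \<open>auto intro!: capped_antimono[OF B]\<close>)
  have m2: "mono_on {0..\<theta>} ?B"
    by (intro mono_onI add_mono mult_right_mono)
       (use assms in \<open>auto intro!: capped_antimono[OF A] tail_prob_mono\<close>)
  have eq: "killed w f x = ?A x - ?B x" if "x \<in> {0..\<theta>}" for x
  proof -
    have "killed w f x = (\<Sum>k=m..<w. trans_prob k x * (A (branch k x) - B (branch k x)))"
      unfolding killed_def using that assms branch_in[of _ x] by (intro sum.cong) (auto simp: f)
    then have "killed w f x = killed w A x - killed w B x"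
      by (simp add: killed_def right_diff_distrib sum_subtractf)
    moreover have "f ?c = A ?c - B ?c" using branch_in[of w 0] assms by (simp add: f)
    ultimately show ?thesis by (simp add: capped_def right_diff_distrib)
  qed
  have A0: "A 0 \<le> A \<theta>" "B 0 \<le> B \<theta>" using tp by (auto intro!: mono_onD[OF A] mono_onD[OF B])
  have d1: "?A \<theta> - ?A 0 \<le> (B \<theta> - B 0) / (real m + 1)" using capped_drop[OF B assms(2)] by simp
  have "tail_prob w \<theta> - tail_prob w 0 = (real m + 1) / (real w + 1) - real m / real w"
    using assms by (simp add: tail_prob_0 tail_prob_theta)
  also have "\<dots> \<le> (real m + 1) / real w - real m / real w"
    using assms m_pos by (intro diff_right_mono divide_left_mono) auto
  also have "\<dots> = 1 / real w" by (simp flip: diff_divide_distrib)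
  finally have "(tail_prob w \<theta> - tail_prob w 0) * f ?c \<le> 1 / real w * f ?c"
    using assms by (intro mult_right_mono)
  then have d2: "?B \<theta> - ?B 0 \<le> (A \<theta> - A 0) / (real m + 1) + f ?c / real w"
    using capped_drop[OF A assms(2)] by (simp add: algebra_simps)
  have halve: "d / (real m + 1) \<le> d / 2" if "d \<ge> 0" for d
    by (rule divide_left_mono) (use that m_pos in auto)
  have "(?A \<theta> - ?A 0) + (?B \<theta> - ?B 0)
      \<le> (B \<theta> - B 0) / 2 + ((A \<theta> - A 0) / 2 + f ?c / real w)"
    using order_trans[OF d1 halve] order_trans[OF d2 add_right_mono[OF halve]] A0
    by (intro add_mono) auto
  also have "\<dots> \<le> v / 2 + f ?c / real w" using v by (simp add: diff_divide_distrib)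
  finally have "(?A \<theta> - ?A 0) + (?B \<theta> - ?B 0) \<le> v / 2 + f ?c / real w" .
  then show ?thesis using m1 m2 eq unfolding osc_le_def by blast
qed

section \<open>The surviving mass and its density\<close>

definition gauss_density :: "real \<Rightarrow> real" where
  "gauss_density x = 1 / ln (1 + \<theta>\<^sup>2) * (\<theta> / (1 + \<theta> * x))"

definition gauss_cdf :: "real \<Rightarrow> real" where
  "gauss_cdf x = ln (1 + \<theta> * x) / ln (1 + \<theta>\<^sup>2)"

lemma ln_norm_pos: "ln (1 + \<theta>\<^sup>2) > 0"
  using theta_pos by (intro ln_gt_zero) simp

lemma one_plus_pos: "0 \<le> x \<Longrightarrow> 1 + \<theta> * x > 0"
  using theta_pos by (simp add: add_pos_nonneg)

lemma gauss_density_nonneg: "0 \<le> x \<Longrightarrow> gauss_density x \<ge> 0"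
  using ln_norm_pos theta_pos one_plus_pos[of x] by (simp add: gauss_density_def)

lemma gauss_cdf_deriv:
  "0 \<le> x \<Longrightarrow> (gauss_cdf has_real_derivative gauss_density x) (at x)"
  unfolding gauss_cdf_def gauss_density_def using one_plus_pos[of x] ln_norm_pos
  by (auto intro!: derivative_eq_intros)

lemma gauss_cdf_0: "gauss_cdf 0 = 0" by (simp add: gauss_cdf_def)

lemma gauss_cdf_theta: "gauss_cdf \<theta> = 1"
  using ln_norm_pos by (simp add: gauss_cdf_def power2_eq_square)

text \<open>
  This identity makes \<open>trans_prob\<close> the kernel of the transfer operator: the left-hand side is the
  Gauss density transported along the \<open>k\<close>-th inverse branch.
\<close>
lemma gauss_density_branch:
  assumes "m \<le> k" "0 \<le> x"
  shows "gauss_density (branch k x) / (real k * \<theta> + x)\<^sup>2 = trans_prob k x * gauss_density x"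
proof -
  define p where "p = real k * \<theta> + x"
  have p: "p > 0" using denom_pos assms by (simp add: p_def)
  have q: "real (Suc k) * \<theta> + x = p + \<theta>" by (simp add: p_def algebra_simps)
  have "1 + \<theta> * (1 / p) = (p + \<theta>) / p" using p by (simp add: field_simps)
  then have "\<theta> / (1 + \<theta> * (1 / p)) / p\<^sup>2 = \<theta> / (p * (p + \<theta>))"
    using p by (simp add: power2_eq_square)
  also have "\<dots> = (1 + \<theta> * x) / (p * (p + \<theta>)) * (\<theta> / (1 + \<theta> * x))"
    using one_plus_pos[OF assms(2)] by simp
  finally have "\<theta> / (1 + \<theta> * (1 / p)) / p\<^sup>2
    = (1 + \<theta> * x) / (p * (p + \<theta>)) * (\<theta> / (1 + \<theta> * x))" .
  moreover have "c * D / P = T * (c * D')" if "D / P = T * D'" for c D P T D' :: real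
  proof -
    have "c * D / P = c * (D / P)" by simp
    then show ?thesis by (simp only: that mult.left_commute)
  qed
  ultimately show ?thesis
    unfolding gauss_density_def trans_prob_def branch_def q p_def[symmetric] by blast
qed

text \<open>
  The density, relative to \<open>\<gamma>\<^sub>\<theta>\<close>, of \<open>T\<^sup>n\<close> on the points whose first \<open>n\<close> digits are below \<open>w\<close>.
\<close>
primrec surv :: "nat \<Rightarrow> nat \<Rightarrow> real \<Rightarrow> real" where
  "surv w 0 = (\<lambda>x. 1)"
| "surv w (Suc n) = killed w (surv w n)"

text \<open>
  The corresponding distribution function: \<open>mass w n x\<close> is the \<open>\<gamma>\<^sub>\<theta>\<close>-measure of the points whose first
  \<open>n\<close> digits are below \<open>w\<close> and whose \<open>n\<close>-th iterate is at most \<open>x\<close>. In the recursion, the \<open>k\<close>-th term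
  accounts for the points whose next digit is \<open>k\<close>.
\<close>
primrec mass :: "nat \<Rightarrow> nat \<Rightarrow> real \<Rightarrow> real" where
  "mass w 0 = gauss_cdf"
| "mass w (Suc n) = (\<lambda>x. \<Sum>k=m..<w. mass w n (branch k 0) - mass w n (branch k x))"

lemma mass_deriv:
  "0 \<le> x \<Longrightarrow> (mass w n has_real_derivative surv w n x * gauss_density x) (at x)"
proof (induction n arbitrary: x)
  case 0
  then show ?case using gauss_cdf_deriv by simp
next
  case (Suc n)
  have "((\<lambda>x. mass w n (branch k 0) - mass w n (branch k x)) has_real_derivative
        trans_prob k x * surv w n (branch k x) * gauss_density x) (at x)" if "k \<in> {m..<w}" for k
  proof -
    have k: "m \<le> k" using that by simp
    have p: "real k * \<theta> + x \<noteq> 0" using denom_pos[of k x] k Suc.prems by simp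
    have b: "(branch k has_real_derivative - (1 / (real k * \<theta> + x)\<^sup>2)) (at x)"
      unfolding branch_def using p
      by (auto intro!: derivative_eq_intros simp: power2_eq_square)
    have "((\<lambda>x. mass w n (branch k 0) - mass w n (branch k x)) has_real_derivative
        0 - surv w n (branch k x) * gauss_density (branch k x) * - (1 / (real k * \<theta> + x)\<^sup>2)) (at x)"
      by (intro DERIV_diff DERIV_const DERIV_chain2[OF Suc.IH b] less_imp_le[OF branch_pos] k Suc.prems)
    also have "0 - surv w n (branch k x) * gauss_density (branch k x) * - (1 / (real k * \<theta> + x)\<^sup>2)
      = surv w n (branch k x) * (gauss_density (branch k x) / (real k * \<theta> + x)\<^sup>2)" by simp
    also have "\<dots> = trans_prob k x * surv w n (branch k x) * gauss_density x"
      unfolding gauss_density_branch[OF k Suc.prems] by simp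
    finally show ?thesis .
  qed
  then show ?case unfolding surv.simps mass.simps killed_def sum_distrib_right
    by (intro DERIV_sum) auto
qed

lemma mass_0: "mass w n 0 = 0"
  by (cases n) (simp_all add: gauss_cdf_0)

text \<open>
  A bound on the density integrates to a bound on the mass; monotonicity of the difference replaces
  the integral.
\<close>
lemma mass_ge:
  assumes "\<And>z. z \<in> {0..\<theta>} \<Longrightarrow> lo \<le> surv w n z" "x \<in> {0..\<theta>}"
  shows "lo * gauss_cdf x \<le> mass w n x"
proof -
  define D where "D = (\<lambda>z. mass w n z - lo * gauss_cdf z)"
  have "D 0 \<le> D x"
  proof (rule DERIV_nonneg_imp_nondecreasing[where f = D])
    show "0 \<le> x" using assms(2) by simp
    fix z assume z: "0 \<le> z" "z \<le> x"
    have "(D has_real_derivative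
      surv w n z * gauss_density z - lo * gauss_density z) (at z)"
      unfolding D_def by (intro DERIV_diff DERIV_cmult mass_deriv gauss_cdf_deriv z)
    moreover have "lo * gauss_density z \<le> surv w n z * gauss_density z"
      using z assms by (intro mult_right_mono gauss_density_nonneg) auto
    ultimately show "\<exists>d. (D has_real_derivative d) (at z) \<and> 0 \<le> d"
      by force
  qed
  then show ?thesis by (simp add: D_def mass_0 gauss_cdf_0)
qed

lemma mass_le:
  assumes "\<And>z. z \<in> {0..\<theta>} \<Longrightarrow> surv w n z \<le> hi" "x \<in> {0..\<theta>}"
  shows "mass w n x \<le> hi * gauss_cdf x"
proof -
  define D where "D = (\<lambda>z. hi * gauss_cdf z - mass w n z)"
  have "D 0 \<le> D x"
  proof (rule DERIV_nonneg_imp_nondecreasing[where f = D])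
    show "0 \<le> x" using assms(2) by simp
    fix z assume z: "0 \<le> z" "z \<le> x"
    have "(D has_real_derivative
      hi * gauss_density z - surv w n z * gauss_density z) (at z)"
      unfolding D_def by (intro DERIV_diff DERIV_cmult mass_deriv gauss_cdf_deriv z)
    moreover have "surv w n z * gauss_density z \<le> hi * gauss_density z"
      using z assms by (intro mult_right_mono gauss_density_nonneg) auto
    ultimately show "\<exists>d. (D has_real_derivative d) (at z) \<and> 0 \<le> d"
      by force
  qed
  then show ?thesis by (simp add: D_def mass_0 gauss_cdf_0)
qed

text \<open>
  The end point of each branch is the starting point of the next one, so the sum telescopes. The lost
  mass is that of the points whose next digit is at least \<open>w\<close>.
\<close>
lemma mass_Suc_theta:
  assumes "m \<le> w"
  shows "mass w (Suc n) \<theta> = mass w n \<theta> - mass w n (branch w 0)"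
proof -
  have "(\<Sum>k=m..<w. f (branch k 0) - f (branch k \<theta>)) = f \<theta> - f (branch w 0)" for f :: "real \<Rightarrow> real"
    using assms by (induction w rule: dec_induct) (simp_all add: branch_m_0 branch_theta)
  then show ?thesis by simp
qed

lemma killed_ge:
  assumes "m \<le> w" "0 \<le> x" "\<And>z. z \<in> {0..\<theta>} \<Longrightarrow> lo \<le> f z"
  shows "(1 - tail_prob w x) * lo \<le> killed w f x"
  unfolding sum_trans_prob[OF assms(1,2), symmetric] sum_distrib_right killed_def
  by (intro sum_mono mult_left_mono trans_prob_nonneg assms branch_in) (use assms in auto)

lemma killed_le:
  assumes "m \<le> w" "0 \<le> x" "\<And>z. z \<in> {0..\<theta>} \<Longrightarrow> f z \<le> hi"
  shows "killed w f x \<le> (1 - tail_prob w x) * hi"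
  unfolding sum_trans_prob[OF assms(1,2), symmetric] sum_distrib_right killed_def
  by (intro sum_mono mult_left_mono trans_prob_nonneg assms branch_in) (use assms in auto)

lemma surv_le:
  assumes "m \<le> w" "0 \<le> x"
  shows "surv w n x \<le> (1 - real m / real w) ^ n"
  using assms(2)
proof (induction n arbitrary: x)
  case 0
  then show ?case by simp
next
  case (Suc n)
  have mw: "real m / real w \<le> 1" using assms m_pos by simp
  have "killed w (surv w n) x \<le> (1 - tail_prob w x) * (1 - real m / real w) ^ n"
    using assms Suc by (intro killed_le) auto
  also have "\<dots> \<le> (1 - real m / real w) * (1 - real m / real w) ^ n"
    using tail_prob_mono[OF assms(1), of 0 x] Suc.prems mw
    by (intro mult_right_mono zero_le_power) (auto simp: tail_prob_0)
  finally show ?case by simp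
qed

lemma mass_le_power:
  assumes "m \<le> w"
  shows "mass w n \<theta> \<le> (1 - real m / real w) ^ n"
  using mass_le[of w n "(1 - real m / real w) ^ n" \<theta>] surv_le[OF assms] theta_pos
  by (simp add: gauss_cdf_theta)

lemma mass_nonneg_theta: "mass w n \<theta> \<ge> 0"
proof -
  have "surv w n x \<ge> 0" if "0 \<le> x" for x
    using that
  proof (induction n arbitrary: x)
    case (Suc n)
    then show ?case unfolding surv.simps killed_def
      by (intro sum_nonneg mult_nonneg_nonneg trans_prob_nonneg Suc.IH less_imp_le[OF branch_pos]) auto
  qed simp
  then show ?thesis using mass_ge[of 0 w n \<theta>] theta_pos by simp
qed

text \<open>
  The relative oscillation \<open>4/w\<close> reproduces itself: by \<open>osc_le_killed\<close> the new oscillation is at most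
  \<open>(4/2 + 1 + small) r / w\<close> with \<open>r = surv w n 0\<close>, while the new value at \<open>0\<close> is at least
  \<open>(1 - m/w) (1 - 4/w) r\<close>. For \<open>w \<ge> 40 m\<close> the latter exceeds \<open>0.87 r\<close>, and \<open>3.1 < 4 \<cdot> 0.87\<close>.
\<close>
lemma surv_flat:
  assumes w: "w \<ge> 40 * m"
  shows "surv w n 0 > 0 \<and> (\<exists>v. osc_le (surv w n) v \<and> v \<le> 4 / real w * surv w n 0)"
proof (induction n)
  case 0
  have "osc_le (\<lambda>x. 1) 0" unfolding osc_le_def
    by (rule exI[of _ "\<lambda>x. 1"], rule exI[of _ "\<lambda>x. 0"]) (auto intro: mono_onI)
  then show ?case by (auto intro!: exI[of _ 0])
next
  case (Suc n)
  define r where "r = surv w n 0"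
  obtain v where r: "r > 0" and osc: "osc_le (surv w n) v" and v: "v \<le> 4 / real w * r"
    using Suc unfolding r_def by blast
  have mw: "m \<le> w" using w by simp
  have "real w \<ge> 40 * real m" using w by (metis of_nat_le_iff of_nat_mult of_nat_numeral)
  then have w': "real w \<ge> 40" and mdiv: "real m / real w \<le> 1 / 40" using m_pos by (auto simp: field_simps)
  define z where "z = 1 / real w"
  have z: "0 < z" "z \<le> 1/40" using w' by (auto simp: z_def field_simps)
  have v: "v \<le> 4 * z * r" using v by (simp add: z_def)
  have near: "\<bar>surv w n x - r\<bar> \<le> v" if "x \<in> {0..\<theta>}" for x
    using osc_le_diff[OF osc that] by (simp add: r_def)
  have zr: "z * r \<le> 1 / 40 * r" using z r by (intro mult_right_mono) auto
  have "(1 - tail_prob w 0) * (r - 4 * z * r) \<le> surv w (Suc n) 0"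
    unfolding surv.simps using near v by (intro killed_ge mw) (fastforce)+
  moreover have "39 / 40 * (r - 4 * z * r) \<le> (1 - tail_prob w 0) * (r - 4 * z * r)"
    using mdiv r zr by (intro mult_right_mono) (auto simp: tail_prob_0)
  moreover have "39 / 40 * (r - 4 * z * r) \<ge> 0.8775 * r"
    using zr by (simp add: algebra_simps)
  ultimately have low: "surv w (Suc n) 0 \<ge> 0.8775 * r" by linarith
  have c: "branch w 0 \<in> {0..\<theta>}" using branch_in mw by simp
  have fc: "surv w n (branch w 0) \<ge> 0" "surv w n (branch w 0) \<le> 1.1 * r"
    using near[OF c] v zr r by linarith+
  have osc': "osc_le (surv w (Suc n)) (v / 2 + surv w n (branch w 0) / real w)"
    using osc_le_killed[OF osc mw fc(1)] by simp
  have "v / 2 + surv w n (branch w 0) / real w \<le> 2 * z * r + 1.1 * z * r"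
    using v mult_left_mono[OF fc(2), of z] z by (simp add: z_def)
  also have "\<dots> \<le> 4 * z * (0.8775 * r)" using z r by simp
  also have "\<dots> \<le> 4 * z * surv w (Suc n) 0" using low z by (intro mult_left_mono) auto
  finally have "v / 2 + surv w n (branch w 0) / real w \<le> 4 / real w * surv w (Suc n) 0"
    by (simp add: z_def)
  moreover have "surv w (Suc n) 0 > 0" using low r by simp
  ultimately show ?case using osc' by blast
qed

definition digit_tail :: "nat \<Rightarrow> real" where "digit_tail w = gauss_cdf (branch w 0)"

lemma digit_tail_eq: "m \<le> w \<Longrightarrow> digit_tail w = ln (1 + 1 / real w) / ln (1 + \<theta>\<^sup>2)"
  using theta_pos unfolding digit_tail_def gauss_cdf_def branch_def by simp

lemma digit_tail_nonneg: "m \<le> w \<Longrightarrow> digit_tail w \<ge> 0"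
  using ln_norm_pos by (simp add: digit_tail_eq)

text \<open>
  As \<open>surv w n\<close> varies by a factor of at most \<open>(1 + 4/w) / (1 - 4/w) \<le> 1 + 10/w\<close>, the fraction of the
  mass lying below \<open>branch w 0\<close> is \<open>digit_tail w\<close> up to such a factor.
\<close>
lemma mass_step:
  assumes w: "w \<ge> 40 * m"
  shows "(1 - digit_tail w * (1 + 10 / real w)) * mass w n \<theta> \<le> mass w (Suc n) \<theta>"
    and "mass w (Suc n) \<theta> \<le> (1 - digit_tail w * (1 - 10 / real w)) * mass w n \<theta>"
proof -
  define r where "r = surv w n 0"
  obtain v where r: "r > 0" and osc: "osc_le (surv w n) v" and v: "v \<le> 4 / real w * r"
    using surv_flat[OF w, of n] unfolding r_def by blast
  have mw: "m \<le> w" using w by simp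
  have "real w \<ge> 40 * real m" using w by (metis of_nat_le_iff of_nat_mult of_nat_numeral)
  then have w': "real w \<ge> 40" using m_pos by simp
  define z where "z = 1 / real w"
  have z: "0 < z" "z \<le> 1/40" using w' by (auto simp: z_def field_simps)
  have v: "v \<le> 4 * z * r" using v by (simp add: z_def)
  have near: "\<bar>surv w n x - r\<bar> \<le> v" if "x \<in> {0..\<theta>}" for x
    using osc_le_diff[OF osc that] by (simp add: r_def)
  define lo hi where "lo = (1 - 4 * z) * r" and "hi = (1 + 4 * z) * r"
  have lohi: "lo \<le> surv w n x" "surv w n x \<le> hi" if "x \<in> {0..\<theta>}" for x
    using near[OF that] v by (auto simp: lo_def hi_def algebra_simps)
  have tp: "\<theta> \<in> {0..\<theta>}" using theta_pos by simp
  have c: "branch w 0 \<in> {0..\<theta>}" using branch_in mw by simp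
  define a p where "a = mass w n \<theta>" and "p = digit_tail w"
  have a: "lo \<le> a" "a \<le> hi"
    using mass_ge[OF lohi(1) tp] mass_le[OF lohi(2) tp] by (auto simp: a_def gauss_cdf_theta)
  have p: "p \<ge> 0" using digit_tail_nonneg mw by (simp add: p_def)
  have zz: "40 * (z * z) \<le> 1 * z" using z by (simp add: mult_right_mono)
  have "hi = (1 + 4 * z) * r" by (simp add: hi_def)
  also have "\<dots> \<le> ((1 + 10 * z) * (1 - 4 * z)) * r"
    using zz z r by (intro mult_right_mono) (auto simp: algebra_simps)
  also have "\<dots> = (1 + 10 * z) * lo" by (simp add: lo_def)
  also have "\<dots> \<le> (1 + 10 * z) * a" using a z by (intro mult_left_mono) auto
  finally have h: "hi \<le> (1 + 10 * z) * a" .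
  have "(1 - 10 * z) * a \<le> (1 - 10 * z) * hi" using a z by (intro mult_left_mono) auto
  also have "\<dots> = ((1 - 10 * z) * (1 + 4 * z)) * r" by (simp add: hi_def)
  also have "\<dots> \<le> (1 - 4 * z) * r"
    using zz z r by (intro mult_right_mono) (auto simp: algebra_simps)
  finally have l: "(1 - 10 * z) * a \<le> lo" by (simp add: lo_def)
  have "mass w n (branch w 0) \<le> hi * p"
    using mass_le[OF lohi(2) c] by (simp add: p_def digit_tail_def)
  also have "\<dots> \<le> ((1 + 10 * z) * a) * p" using h p by (intro mult_right_mono)
  finally show "(1 - digit_tail w * (1 + 10 / real w)) * mass w n \<theta> \<le> mass w (Suc n) \<theta>"
    unfolding mass_Suc_theta[OF mw] by (simp add: a_def p_def z_def algebra_simps)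
  have "((1 - 10 * z) * a) * p \<le> lo * p" using l p by (intro mult_right_mono)
  also have "\<dots> \<le> mass w n (branch w 0)"
    using mass_ge[OF lohi(1) c] by (simp add: p_def digit_tail_def)
  finally show "mass w (Suc n) \<theta> \<le> (1 - digit_tail w * (1 - 10 / real w)) * mass w n \<theta>"
    unfolding mass_Suc_theta[OF mw] by (simp add: a_def p_def z_def algebra_simps)
qed

lemma mass_power_bounds:
  assumes w: "w \<ge> 40 * m" and q: "digit_tail w * (1 + 10 / real w) \<le> 1"
  shows "(1 - digit_tail w * (1 + 10 / real w)) ^ n \<le> mass w n \<theta>"
    and "mass w n \<theta> \<le> (1 - digit_tail w * (1 - 10 / real w)) ^ n"
proof -
  have mw: "m \<le> w" using w by simp
  have q': "digit_tail w * (1 - 10 / real w) \<le> 1"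
    by (rule order_trans[OF mult_left_mono q]) (use digit_tail_nonneg[OF mw] in auto)
  show "(1 - digit_tail w * (1 + 10 / real w)) ^ n \<le> mass w n \<theta>"
  proof (induction n)
    case (Suc n)
    show ?case using mult_left_mono[OF Suc, of "1 - digit_tail w * (1 + 10 / real w)"] q mass_step(1)[OF w, of n]
      by (simp del: mass.simps)
  qed (simp add: gauss_cdf_theta)
  show "mass w n \<theta> \<le> (1 - digit_tail w * (1 - 10 / real w)) ^ n"
  proof (induction n)
    case (Suc n)
    show ?case using mult_left_mono[OF Suc, of "1 - digit_tail w * (1 - 10 / real w)"] q' mass_step(2)[OF w, of n]
      by (simp del: mass.simps)
  qed (simp add: gauss_cdf_theta)
qed

section \<open>The limit law for the surviving mass\<close>

lemma ln_norm_bounds: "1 / (real m + 1) \<le> ln (1 + \<theta>\<^sup>2)" "ln (1 + \<theta>\<^sup>2) \<le> 1 / real m"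
proof -
  have "ln (1 / (1 + 1 / real m)) \<le> 1 / (1 + 1 / real m) - 1"
    using m_pos by (intro ln_le_minus_one) (simp add: add_pos_nonneg)
  moreover have "ln (1 / (1 + 1 / real m)) = - ln (1 + 1 / real m)"
    using m_pos by (subst ln_div) (auto simp: add_pos_nonneg)
  moreover have "1 / (1 + 1 / real m) - 1 = - (1 / (real m + 1))" using m_pos by (simp add: field_simps)
  ultimately show "1 / (real m + 1) \<le> ln (1 + \<theta>\<^sup>2)" by (simp add: theta_sq2)
  show "ln (1 + \<theta>\<^sup>2) \<le> 1 / real m"
    using ln_add_one_self_le_self[of "1 / real m"] by (simp add: theta_sq2)
qed

text \<open>
  Each step loses at least the fraction \<open>m / w \<ge> 1/40\<close> of the mass; for \<open>w \<le> m\<close> nothing survives.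
\<close>
lemma mass_small_threshold:
  assumes "N \<ge> 1" "w \<le> 40 * m"
  shows "mass w N \<theta> \<le> exp (- (real N / 40))"
proof (cases "m \<le> w")
  case True
  have "real m / real w \<ge> 1 / 40" using True m_pos assms(2)
    by (simp add: field_simps)
  then have 1: "1 - real m / real w \<le> exp (- (1/40))"
    using exp_ge_add_one_self[of "- (1/40)"] by simp
  have "mass w N \<theta> \<le> (1 - real m / real w) ^ N" by (rule mass_le_power[OF True])
  also have "\<dots> \<le> exp (- (1/40)) ^ N" using 1 True m_pos by (intro power_mono) auto
  also have "\<dots> = exp (- (real N / 40))" by (simp flip: exp_of_nat_mult)
  finally show ?thesis .
next
  case False
  then have "mass w N \<theta> = 0" using assms(1) by (cases N) auto
  then show ?thesis by simp
qed

text \<open>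
  In terms of \<open>z = 1/W\<close> and \<open>K = ln (1 + \<theta>\<^sup>2)\<close> one has \<open>t = N z / K\<close>, and \<open>p\<close> equals \<open>z / K\<close> up to a factor
  \<open>1 + O(z)\<close>. Hence \<open>mass w N \<theta>\<close> lies between \<open>exp(-t - x)\<close> and \<open>exp(-t + x)\<close> with
  \<open>x = 17 m z t = 17 m K t\<^sup>2 / N \<le> 17 t\<^sup>2 / N\<close>. In the constant \<open>17 m\<close>, a part \<open>12\<close> covers
  the factors \<open>1 \<plusminus> 10 z\<close> of \<open>mass_power_bounds\<close> and \<open>1 - 2 z\<close> of the lower bound for \<open>p\<close>, and \<open>5 m\<close> covers
  the quadratic term of \<open>ln (1 - q)\<close>, where \<open>1/K \<le> m + 1 \<le> 2 m\<close> gives \<open>2 q \<le> 5 m z\<close>.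
\<close>
lemma mass_large_threshold:
  assumes W: "W > 40 * real m" and w: "W \<le> real w" "real w < W + 1" and N: "N \<ge> 1"
  defines "t \<equiv> real N / (ln (1 + \<theta>\<^sup>2) * W)"
  shows "\<bar>mass w N \<theta> - exp (- t)\<bar> \<le> 136 / real N"
proof -
  define K where "K = ln (1 + \<theta>\<^sup>2)"
  have K: "K > 0" "1 / K \<le> real m + 1" "K * real m \<le> 1"
    using ln_norm_pos ln_norm_bounds m_pos by (auto simp: K_def field_simps)
  have W0: "W > 40" using W m_pos by linarith
  have "real w > 40 * real m" using W w by linarith
  then have "real w > real (40 * m)" by simp
  then have wm: "w \<ge> 40 * m" by (simp only: of_nat_less_iff less_imp_le)
  have mw: "m \<le> w" using wm by simp
  define z where "z = 1 / W"
  have z: "0 < z" "z < 1/40" "z * real m < 1/40" using W W0 by (auto simp: z_def field_simps)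
  have t: "t = real N * (z / K)" by (simp add: t_def z_def K_def field_simps)
  have t0: "t \<ge> 0" using z K by (simp add: t)
  define x where "x = 17 * real m * z * t"
  have x: "0 \<le> x" "x \<le> t / 2"
  proof -
    show "0 \<le> x" using z t0 by (simp add: x_def)
    have "17 * (z * real m) * t \<le> 1/2 * t" using z t0 by (intro mult_right_mono) auto
    then show "x \<le> t / 2" by (simp add: x_def mult_ac)
  qed
  define p where "p = digit_tail w"
  have p0: "p \<ge> 0" using digit_tail_nonneg[OF mw] by (simp add: p_def)
  have wpos: "real w > 40" using W0 w by simp
  have wz: "1 / real w \<le> z" using w W0 by (simp add: z_def field_simps)
  have "ln (1 + 1 / real w) \<le> 1 / real w" using wpos by (intro ln_add_one_self_le_self) simp
  then have "ln (1 + 1 / real w) \<le> z" using wz by linarith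
  then have p_up: "p \<le> z / K" using K unfolding p_def digit_tail_eq[OF mw] K_def[symmetric]
    by (intro divide_right_mono) auto
  have p_low: "z * (1 - 2 * z) / K \<le> p"
  proof -
    have "ln (1 / (1 + 1 / real w)) \<le> 1 / (1 + 1 / real w) - 1"
      using wpos by (intro ln_le_minus_one) (simp add: add_pos_nonneg)
    moreover have "ln (1 / (1 + 1 / real w)) = - ln (1 + 1 / real w)"
      using wpos by (subst ln_div) (auto simp: add_pos_nonneg)
    moreover have "1 / (1 + 1 / real w) - 1 = - (1 / (real w + 1))" using wpos by (simp add: field_simps)
    ultimately have "1 / (real w + 1) \<le> ln (1 + 1 / real w)" by simp
    moreover have "1 / (W + 2) \<le> 1 / (real w + 1)" using w W0 by (intro divide_left_mono) auto
    moreover have "z * (1 - 2 * z) \<le> 1 / (W + 2)"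
    proof -
      have "(W - 2) * (W + 2) \<le> W * W" by (simp add: algebra_simps)
      then have "(W - 2) / (W * W) \<le> 1 / (W + 2)" using W0 by (simp add: field_simps)
      moreover have "z * (1 - 2 * z) = (W - 2) / (W * W)" using W0 by (simp add: z_def field_simps)
      ultimately show ?thesis by simp
    qed
    ultimately have "z * (1 - 2 * z) \<le> ln (1 + 1 / real w)" by linarith
    then show ?thesis using K unfolding p_def digit_tail_eq[OF mw] K_def[symmetric]
      by (intro divide_right_mono) auto
  qed
  define q where "q = p * (1 + 10 / real w)"
  have ten: "10 / real w \<le> 10 * z" using wz by simp
  have q0: "q \<ge> 0" using p0 by (simp add: q_def)
  have q1: "q \<le> z / K * (1 + 10 * z)"
    unfolding q_def using p_up ten p0 z K by (intro mult_mono) auto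
  have zK: "z / K \<le> 1 / 20"
  proof -
    have "z * (1 / K) \<le> z * (real m + 1)" using K z by (intro mult_left_mono) auto
    also have "\<dots> \<le> 1 / 20" using z by (simp add: algebra_simps)
    finally show ?thesis by simp
  qed
  have q2: "q \<le> 5/4 * (z / K)"
    using q1 mult_left_mono[of "1 + 10 * z" "5/4" "z / K"] z K by simp
  have q3: "q \<le> 1/2" using q2 zK by linarith
  have "digit_tail w * (1 + 10 / real w) \<le> 1" using q3 unfolding q_def p_def by linarith
  note bounds = mass_power_bounds[OF wm this, of N, folded p_def, folded q_def]
  have Kz: "z / K \<le> 2 * real m * z"
  proof -
    have "z * (1 / K) \<le> z * (2 * real m)" using K z m_pos by (intro mult_left_mono) auto
    then show ?thesis by (simp add: mult_ac)
  qed
  have m1: "real m \<ge> 1" using m_pos by simp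
  have zm: "z \<le> z * real m" using z m1 by simp
  have upper: "mass w N \<theta> \<le> exp (- t + x)"
  proof -
    have "(1 - 10 * z) * (1 - 2 * z) \<ge> 1 - 12 * z" using z by (simp add: algebra_simps)
    then have "(z / K) * (1 - 12 * z) \<le> (z / K) * ((1 - 10 * z) * (1 - 2 * z))"
      using z K by (intro mult_left_mono) auto
    also have "\<dots> = (z * (1 - 2 * z) / K) * (1 - 10 * z)" by simp
    also have "\<dots> \<le> p * (1 - 10 / real w)" using p_low ten z p0 by (intro mult_mono) auto
    finally have "real N * ((z / K) * (1 - 12 * z)) \<le> real N * (p * (1 - 10 / real w))"
      by (rule mult_left_mono) simp
    then have e: "t * (1 - 12 * z) \<le> real N * (p * (1 - 10 / real w))" by (simp add: t mult_ac)
    have "12 * z \<le> 17 * real m * z" using zm z by (simp add: mult_ac)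
    then have "12 * z * t \<le> 17 * real m * z * t" using t0 by (rule mult_right_mono)
    then have "t - x \<le> t * (1 - 12 * z)" by (simp add: x_def algebra_simps)
    then have e2: "t - x \<le> real N * (p * (1 - 10 / real w))" using e by linarith
    have "p * (1 - 10 / real w) \<le> q" unfolding q_def using p0 by (intro mult_left_mono) auto
    then have nn: "0 \<le> 1 - p * (1 - 10 / real w)" using q3 by linarith
    have "mass w N \<theta> \<le> (1 - p * (1 - 10 / real w)) ^ N" by (rule bounds(2))
    also have "\<dots> \<le> exp (- (p * (1 - 10 / real w))) ^ N"
      using nn exp_ge_add_one_self[of "- (p * (1 - 10 / real w))"] by (intro power_mono) auto
    also have "\<dots> = exp (- (real N * (p * (1 - 10 / real w))))" by (simp flip: exp_of_nat_mult)
    also have "\<dots> \<le> exp (- t + x)" using e2 by simp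
    finally show ?thesis .
  qed
  have lower: "exp (- t - x) \<le> mass w N \<theta>"
  proof -
    have "- q - 2 * q\<^sup>2 \<le> ln (1 - q)" using q0 q3 by (rule ln_one_minus_pos_lower_bound)
    then have "exp (- q - 2 * q\<^sup>2) \<le> exp (ln (1 - q))" by simp
    then have e1: "exp (- q - 2 * q\<^sup>2) \<le> 1 - q" using q3 by simp
    have "q + 2 * q\<^sup>2 = q * (1 + 2 * q)" by (simp add: power2_eq_square algebra_simps)
    also have "\<dots> \<le> (z / K * (1 + 10 * z)) * (1 + 2 * q)" using q1 q0 by (intro mult_right_mono) auto
    also have "\<dots> = z / K * ((1 + 10 * z) * (1 + 2 * q))" by simp
    also have "\<dots> \<le> z / K * (1 + 17 * real m * z)"
    proof (rule mult_left_mono)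
      have q5: "2 * q \<le> 5 * (real m * z)" using q2 Kz by simp
      have "q \<le> 1 / 16" using q2 zK by linarith
      then have "10 * z * (1 + 2 * q) \<le> 10 * z * (1 + 1/8)"
        using z by (intro mult_left_mono) auto
      moreover have "1 + 2 * q \<le> 1 + 5 * (real m * z)" using q5 by simp
      ultimately have "(1 + 2 * q) + 10 * z * (1 + 2 * q) \<le> (1 + 5 * (real m * z)) + 10 * z * (1 + 1/8)"
        by (rule add_mono[rotated])
      also have "(1 + 2 * q) + 10 * z * (1 + 2 * q) = (1 + 10 * z) * (1 + 2 * q)"
        by (simp add: algebra_simps)
      also have "(1 + 5 * (real m * z)) + 10 * z * (1 + 1/8) \<le> 1 + 5 * (real m * z) + 12 * z"
        using z by simp
      also have "\<dots> \<le> 1 + 17 * real m * z" using zm by (simp add: mult_ac)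
      finally show "(1 + 10 * z) * (1 + 2 * q) \<le> 1 + 17 * real m * z" .
      show "0 \<le> z / K" using z K by simp
    qed
    finally have "real N * (q + 2 * q\<^sup>2) \<le> real N * (z / K * (1 + 17 * real m * z))"
      by (rule mult_left_mono) simp
    also have "\<dots> = t + x" unfolding x_def t by (simp add: algebra_simps)
    finally have "exp (- t - x) \<le> exp (real N * (- q - 2 * q\<^sup>2))" by (simp add: algebra_simps)
    also have "\<dots> = exp (- q - 2 * q\<^sup>2) ^ N" by (simp add: exp_of_nat_mult)
    also have "\<dots> \<le> (1 - q) ^ N" using e1 by (intro power_mono) auto
    also have "\<dots> \<le> mass w N \<theta>" by (rule bounds(1))
    finally show ?thesis .
  qed
  have "\<bar>mass w N \<theta> - exp (- t)\<bar> \<le> x * exp (- (t / 2))"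
    by (rule exp_gap[OF lower upper x])
  also have "x = 17 * (K * real m) * t\<^sup>2 / real N"
    using N K by (simp add: x_def t power2_eq_square)
  also have "17 * (K * real m) * t\<^sup>2 / real N * exp (- (t / 2))
    = 17 / real N * ((K * real m) * (t\<^sup>2 * exp (- (t / 2))))" by simp
  also have "\<dots> \<le> 17 / real N * (1 * 8)"
    using K t0 by (intro mult_left_mono mult_mono square_exp_bound) auto
  finally show ?thesis by simp
qed

text \<open>
  For \<open>W \<le> 40 m\<close> the inequality \<open>m ln (1 + \<theta>\<^sup>2) \<le> 1\<close> gives \<open>1/y \<ge> N/40\<close>, so both terms are at most
  \<open>exp(-N/40)\<close>.
\<close>
lemma mass_frechet_limit:
  assumes "y > 0" "N \<ge> 1"
  shows "\<bar>mass (nat \<lceil>real N * y / ln (1 + \<theta>\<^sup>2)\<rceil>) N \<theta> - exp (- (1 / y))\<bar> \<le> 136 / real N"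
proof -
  define W where "W = real N * y / ln (1 + \<theta>\<^sup>2)"
  define w where "w = nat \<lceil>W\<rceil>"
  have W: "W > 0" using assms ln_norm_pos by (simp add: W_def)
  have w: "W \<le> real w" "real w < W + 1" using W unfolding w_def by linarith+
  have y: "1 / y = real N / (ln (1 + \<theta>\<^sup>2) * W)"
    using assms ln_norm_pos by (simp add: W_def)
  show ?thesis
  proof (cases "W > 40 * real m")
    case True
    show ?thesis using mass_large_threshold[OF True w assms(2)]
      unfolding y[symmetric] by (simp only: w_def W_def)
  next
    case False
    have "w \<le> 40 * m" unfolding w_def using False by (simp add: nat_le_iff ceiling_le_iff)
    then have 1: "mass w N \<theta> \<le> exp (- (real N / 40))" by (rule mass_small_threshold[OF assms(2)])
    have "ln (1 + \<theta>\<^sup>2) * W \<le> 1 / real m * (40 * real m)"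
      using False W ln_norm_pos ln_norm_bounds by (intro mult_mono) auto
    then have "ln (1 + \<theta>\<^sup>2) * W \<le> 40" using m_pos by simp
    then have "1 / y \<ge> real N / 40" unfolding y using ln_norm_pos W
      by (intro divide_left_mono) auto
    then have "exp (- (1 / y)) \<le> exp (- (real N / 40))" by simp
    then have "\<bar>mass w N \<theta> - exp (- (1 / y))\<bar> \<le> exp (- (real N / 40))"
      using 1 mass_nonneg_theta[of w N] by (smt (verit) exp_gt_zero)
    also have "\<dots> \<le> 1 / (real N / 40)" using assms by (intro exp_neg_le_inverse) simp
    also have "\<dots> \<le> 136 / real N" by (simp add: divide_right_mono)
    finally show ?thesis by (simp add: w_def W_def)
  qed
qed

section \<open>The mass function as a Gauss measure\<close>

lemma branch_interval_iff:
  assumes u: "0 < u" "u \<le> \<theta>" and k: "m \<le> k" and x: "0 \<le> x" "x \<le> \<theta>"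
  shows "\<lfloor>1 / (u * \<theta>)\<rfloor> = int k \<and> theta_map \<theta> u < x \<longleftrightarrow> branch k x < u \<and> u \<le> branch k 0" (is ?strict)
    and "x < \<theta> \<Longrightarrow> \<lfloor>1 / (u * \<theta>)\<rfloor> = int k \<and> theta_map \<theta> u \<le> x \<longleftrightarrow> branch k x \<le> u \<and> u \<le> branch k 0"
proof -
  have digit: "\<lfloor>1 / (u * \<theta>)\<rfloor> = int k \<longleftrightarrow> real k * \<theta> \<le> 1 / u \<and> 1 / u < real k * \<theta> + \<theta>"
    using u theta_pos by (simp add: floor_eq_iff field_simps)
  have T: "theta_map \<theta> u = 1 / u - real k * \<theta>" if "\<lfloor>1 / (u * \<theta>)\<rfloor> = int k"
    using that u by (simp add: theta_map_def)
  have b: "branch k x < u \<longleftrightarrow> 1 / u < real k * \<theta> + x" "branch k x \<le> u \<longleftrightarrow> 1 / u \<le> real k * \<theta> + x"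
    using denom_pos[OF k x(1)] u by (simp_all add: branch_def field_simps)
  have b0: "u \<le> branch k 0 \<longleftrightarrow> real k * \<theta> \<le> 1 / u"
    using denom_pos[OF k, of 0] u by (simp add: branch_def field_simps)
  show ?strict unfolding b b0 using digit T x by auto
  show "\<lfloor>1 / (u * \<theta>)\<rfloor> = int k \<and> theta_map \<theta> u \<le> x \<longleftrightarrow> branch k x \<le> u \<and> u \<le> branch k 0"
    if "x < \<theta>"
    unfolding b b0 using digit T x that by auto
qed

lemma floor_ge_m:
  assumes "0 < u" "u \<le> \<theta>" shows "\<lfloor>1 / (u * \<theta>)\<rfloor> \<ge> int m"
proof -
  have "real m * (u * \<theta>) \<le> real m * (\<theta> * \<theta>)"
    using assms theta_pos by (intro mult_left_mono mult_right_mono) auto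
  then have "real m \<le> 1 / (u * \<theta>)" using assms theta_pos theta_sq_m by (simp add: pos_le_divide_eq)
  then show ?thesis by (simp add: le_floor_iff)
qed

lemma theta_map_in:
  assumes "u \<in> {0..\<theta>}" shows "theta_map \<theta> u \<in> {0..<\<theta>}"
proof (cases "u = 0")
  case False
  then have "theta_map \<theta> u = \<theta> * frac (1 / (u * \<theta>))"
    using theta_pos by (simp add: theta_map_def frac_def right_diff_distrib)
  moreover have "\<theta> * frac (1 / (u * \<theta>)) < \<theta> * 1"
    using theta_pos frac_lt_1 by (intro mult_strict_left_mono)
  ultimately show ?thesis using theta_pos by (simp add: frac_ge_0)
qed (use theta_pos in \<open>simp add: theta_map_def\<close>)

lemma orbit_in: "u \<in> {0..\<theta>} \<Longrightarrow> (theta_map \<theta> ^^ n) u \<in> {0..\<theta>}"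
proof (induction n)
  case (Suc n)
  then show ?case using theta_map_in[of "(theta_map \<theta> ^^ n) u"] by auto
qed simp

lemma first_digit_less_iff:
  assumes "u \<in> {0..\<theta>}"
  shows "theta_first_digit \<theta> u < enat w \<longleftrightarrow> u \<noteq> 0 \<and> (\<exists>k\<in>{m..<w}. \<lfloor>1 / (u * \<theta>)\<rfloor> = int k)"
proof (cases "u = 0")
  case False
  then have "\<lfloor>1 / (u * \<theta>)\<rfloor> \<ge> int m" using assms floor_ge_m by auto
  then have "\<lfloor>1 / (u * \<theta>)\<rfloor> = int (nat \<lfloor>1 / (u * \<theta>)\<rfloor>)" "m \<le> nat \<lfloor>1 / (u * \<theta>)\<rfloor>" by linarith+
  then obtain k where "\<lfloor>1 / (u * \<theta>)\<rfloor> = int k" "m \<le> k" by blast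
  then show ?thesis using False by (auto simp: theta_first_digit_def)
qed (simp add: theta_first_digit_def)

definition survivors :: "nat \<Rightarrow> nat \<Rightarrow> real set" where
  "survivors w n = {y \<in> theta_Omega \<theta>. \<forall>j\<in>{1..n}. theta_digit \<theta> j y < enat w}"

lemma survivors_0: "survivors w 0 = theta_Omega \<theta>" by (simp add: survivors_def)

lemma survivors_Suc:
  "survivors w (Suc n) = {y \<in> survivors w n. theta_first_digit \<theta> ((theta_map \<theta> ^^ n) y) < enat w}"
  by (auto simp: survivors_def theta_digit_def atLeastAtMostSuc_conv)

lemma theta_map_measurable [measurable]: "theta_map \<theta> \<in> borel_measurable borel"
  unfolding theta_map_def by measurable

lemma orbit_measurable [measurable]: "(theta_map \<theta> ^^ n) \<in> borel_measurable borel"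
proof (induction n)
  case (Suc n)
  then show ?case using measurable_comp[OF Suc theta_map_measurable] by simp
qed (simp add: id_def)

lemma Omega_sets: "theta_Omega \<theta> \<in> sets borel"
proof -
  have "\<rat> \<in> sets (borel :: real measure)" by (rule sets.countable) (auto simp: countable_rat)
  then show ?thesis unfolding theta_Omega_def by auto
qed

lemma survivors_subset: "survivors w n \<subseteq> {0<..<\<theta>}"
  by (auto simp: survivors_def theta_Omega_def)

lemma orbit_survivors: "y \<in> survivors w n \<Longrightarrow> (theta_map \<theta> ^^ k) y \<in> {0..\<theta>}"
  using survivors_subset[of w n] by (intro orbit_in) auto

lemma survivors_sets [measurable]: "survivors w n \<in> sets borel"
proof (induction n)
  case 0
  then show ?case by (simp add: survivors_0 Omega_sets)
next
  case (Suc n)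
  have nat_floor: "nat \<lfloor>r\<rfloor> < w \<longleftrightarrow> 0 < w \<and> r < real w" for r :: real by linarith
  let ?S = "{y \<in> space borel. (theta_map \<theta> ^^ n) y \<noteq> 0 \<and> 0 < w \<and> 1 / ((theta_map \<theta> ^^ n) y * \<theta>) < real w}"
  have "survivors w (Suc n) = survivors w n \<inter> ?S"
    unfolding survivors_Suc by (auto simp: theta_first_digit_def nat_floor split: if_splits)
  moreover have "?S \<in> sets borel" by measurable
  ultimately show ?case using Suc by simp
qed

lemma gauss_measure_alt:
  "theta_gauss_measure \<theta> = density (restrict_space lborel {0..\<theta>}) (\<lambda>x. ennreal (gauss_density x))"
  by (simp add: theta_gauss_measure_def gauss_density_def)

lemma sets_gauss: "S \<in> sets (theta_gauss_measure \<theta>) \<longleftrightarrow> S \<in> sets borel \<and> S \<subseteq> {0..\<theta>}"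
  by (auto simp: gauss_measure_alt sets_restrict_space_iff)

lemma gauss_density_measurable [measurable]: "gauss_density \<in> borel_measurable borel"
  unfolding gauss_density_def by measurable

lemma emeasure_gauss_Icc:
  assumes "x \<in> {0..\<theta>}"
  shows "emeasure (theta_gauss_measure \<theta>) {0..x} = ennreal (gauss_cdf x)"
proof -
  have "emeasure (theta_gauss_measure \<theta>) {0..x}
     = (\<integral>\<^sup>+z. ennreal (gauss_density z) * indicator {0..x} z \<partial>restrict_space lborel {0..\<theta>})"
    unfolding gauss_measure_alt
    by (rule emeasure_density)
       (use assms in \<open>auto simp: sets_restrict_space_iff intro!: measurable_restrict_space1\<close>)
  also have "\<dots> = (\<integral>\<^sup>+z. ennreal (gauss_density z) * indicator {0..x} z * indicator {0..\<theta>} z \<partial>lborel)"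
    by (rule nn_integral_restrict_space) simp
  also have "\<dots> = (\<integral>\<^sup>+z. ennreal (gauss_density z) * indicator {0..x} z \<partial>lborel)"
    by (rule nn_integral_cong) (use assms in \<open>auto split: split_indicator\<close>)
  also have "\<dots> = ennreal (gauss_cdf x - gauss_cdf 0)"
    by (rule nn_integral_FTC_Icc)
       (use assms in \<open>auto intro!: gauss_cdf_deriv gauss_density_nonneg DERIV_subset[OF gauss_cdf_deriv]\<close>)
  finally show ?thesis by (simp add: gauss_cdf_0)
qed

lemma finite_measure_gauss: "finite_measure (theta_gauss_measure \<theta>)"
proof
  have "space (theta_gauss_measure \<theta>) = {0..\<theta>}" by (simp add: gauss_measure_alt space_restrict_space)
  then show "emeasure (theta_gauss_measure \<theta>) (space (theta_gauss_measure \<theta>)) \<noteq> \<infinity>"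
    using emeasure_gauss_Icc[of \<theta>] theta_pos by simp
qed

lemma gauss_cdf_nonneg: "0 \<le> x \<Longrightarrow> gauss_cdf x \<ge> 0"
  using theta_pos ln_norm_pos by (simp add: gauss_cdf_def)

text \<open>
  A countable exceptional set is null, so the irrational points have the same distribution function.
\<close>
lemma measure_gauss_initial:
  assumes x: "x \<in> {0..\<theta>}" and S: "S \<in> sets borel" "S \<subseteq> {0..x}" and C: "countable C" "{0..x} - C \<subseteq> S"
  shows "measure (theta_gauss_measure \<theta>) S = gauss_cdf x"
proof -
  have "AE z in lborel. z \<notin> C" by (rule AE_not_in[OF countable_imp_null_set_lborel[OF C(1)]])
  then have "AE z in theta_gauss_measure \<theta>. z \<in> S \<longleftrightarrow> z \<in> {0..x}"
    unfolding gauss_measure_alt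
    by (subst AE_density, force simp: measurable_restrict_space1, subst AE_restrict_space_iff)
       (use S C in \<open>auto elim!: eventually_mono\<close>)
  then have "measure (theta_gauss_measure \<theta>) S = measure (theta_gauss_measure \<theta>) {0..x}"
    by (rule measure_eq_AE) (use S x in \<open>auto simp: sets_gauss\<close>)
  also have "\<dots> = gauss_cdf x"
    using emeasure_gauss_Icc[OF x] gauss_cdf_nonneg x by (simp add: measure_def)
  finally show ?thesis .
qed

text \<open>
  Non-strict and strict inequalities are carried through the induction together: the inverse
  branches reverse order, so that the points with \<open>T\<^sup>n\<^sup>+\<^sup>1 y \<le> x\<close> are described by
  \<open>branch k x \<le> T\<^sup>n y\<close>, whose complement is strict. Having equal measure for both is the absence of atoms.
  An orbit may reach \<open>0\<close> even from an irrational point; if \<open>T\<^sup>n y = 0\<close>, then digit \<open>n + 1\<close> is infinite and \<open>y\<close>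
  drops out, in agreement with \<open>0\<close> lying in no branch interval.
\<close>
lemma measure_survivors_below:
  assumes "x \<in> {0..\<theta>}"
  shows "measure (theta_gauss_measure \<theta>) {y \<in> survivors w n. (theta_map \<theta> ^^ n) y \<le> x} = mass w n x \<and>
    measure (theta_gauss_measure \<theta>) {y \<in> survivors w n. (theta_map \<theta> ^^ n) y < x} = mass w n x"
  using assms
proof (induction n arbitrary: x)
  case 0
  have C: "countable (\<rat> \<union> {\<theta>, x})" by (simp add: countable_rat)
  have "{y \<in> theta_Omega \<theta>. y \<le> x} = theta_Omega \<theta> \<inter> {..x}" "{y \<in> theta_Omega \<theta>. y < x} = theta_Omega \<theta> \<inter> {..<x}"
    by auto
  then have "{y \<in> theta_Omega \<theta>. y \<le> x} \<in> sets borel" "{y \<in> theta_Omega \<theta>. y < x} \<in> sets borel"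
    using Omega_sets by auto
  moreover have "{0..x} - (\<rat> \<union> {\<theta>, x}) \<subseteq> {y \<in> theta_Omega \<theta>. y < x}"
    using 0 by (auto simp: theta_Omega_def less_le)
  ultimately show ?case using 0
    by (auto simp: survivors_0 theta_Omega_def intro!: measure_gauss_initial[OF 0 _ _ C])
next
  case (Suc n)
  interpret finite_measure "theta_gauss_measure \<theta>" by (rule finite_measure_gauss)
  let ?\<mu> = "measure (theta_gauss_measure \<theta>)"
  let ?T = "\<lambda>y. (theta_map \<theta> ^^ n) y"
  have orb: "?T y \<in> {0..\<theta>}" if "y \<in> survivors w n" for y
    using orbit_survivors that by blast
  have sts: "{y \<in> survivors w n. ?T y \<le> z} \<in> sets (theta_gauss_measure \<theta>)"
    "{y \<in> survivors w n. ?T y < z} \<in> sets (theta_gauss_measure \<theta>)" for z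
  proof -
    have "{y \<in> survivors w n. ?T y \<le> z} = survivors w n \<inter> {y \<in> space borel. ?T y \<le> z}"
      "{y \<in> survivors w n. ?T y < z} = survivors w n \<inter> {y \<in> space borel. ?T y < z}" by auto
    moreover have survivors_le: "survivors w n \<subseteq> {0..\<theta>}" using survivors_subset[of w n] by auto
    moreover have "survivors w n \<inter> {y \<in> space borel. ?T y \<le> z} \<in> sets borel"
      "survivors w n \<inter> {y \<in> space borel. ?T y < z} \<in> sets borel" by measurable
    ultimately show "{y \<in> survivors w n. ?T y \<le> z} \<in> sets (theta_gauss_measure \<theta>)"
      "{y \<in> survivors w n. ?T y < z} \<in> sets (theta_gauss_measure \<theta>)"
      using survivors_le unfolding sets_gauss by auto
  qed
  \<comment> \<open>Both cases at once: \<open>P\<close> is \<open>< x\<close> or \<open>\<le> x\<close>, and \<open>Q k\<close> describes the points left of the \<open>k\<close>-th branch interval.\<close>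
  have decomp: "?\<mu> {y \<in> survivors w (Suc n). P (theta_map \<theta> (?T y))} = mass w (Suc n) x"
    if iff: "\<And>u k. 0 < u \<Longrightarrow> u \<le> \<theta> \<Longrightarrow> m \<le> k \<Longrightarrow>
        \<lfloor>1 / (u * \<theta>)\<rfloor> = int k \<and> P (theta_map \<theta> u) \<longleftrightarrow> \<not> Q k u \<and> u \<le> branch k 0"
      and Qm: "\<And>k. m \<le> k \<Longrightarrow> {y \<in> survivors w n. Q k (?T y)} \<in> sets (theta_gauss_measure \<theta>)"
      and Qs: "\<And>u k. m \<le> k \<Longrightarrow> Q k u \<Longrightarrow> u \<le> branch k x" "\<And>k. m \<le> k \<Longrightarrow> Q k 0"
      and Q\<mu>: "\<And>k. m \<le> k \<Longrightarrow> ?\<mu> {y \<in> survivors w n. Q k (?T y)} = mass w n (branch k x)"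
    for P Q
  proof -
    let ?D = "\<lambda>k. {y \<in> survivors w n. ?T y \<le> branch k 0} - {y \<in> survivors w n. Q k (?T y)}"
    have D_iff: "y \<in> ?D k \<longleftrightarrow> y \<in> survivors w n \<and> ?T y \<noteq> 0 \<and>
        \<lfloor>1 / (?T y * \<theta>)\<rfloor> = int k \<and> P (theta_map \<theta> (?T y))" if k: "m \<le> k" for y k
    proof (cases "y \<in> survivors w n")
      case True
      show ?thesis
      proof (cases "?T y = 0")
        case True
        then show ?thesis using Qs(2)[OF k] by simp
      next
        case False
        then show ?thesis using True orb[OF True] iff[of "?T y" k] k by auto
      qed
    qed simp
    have "{y \<in> survivors w (Suc n). P (theta_map \<theta> (?T y))} = (\<Union>k\<in>{m..<w}. ?D k)" (is "?L = ?R")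
    proof (intro set_eqI)
      fix y
      have "y \<in> ?R \<longleftrightarrow> (\<exists>k\<in>{m..<w}. y \<in> survivors w n \<and> ?T y \<noteq> 0 \<and>
        \<lfloor>1 / (?T y * \<theta>)\<rfloor> = int k \<and> P (theta_map \<theta> (?T y)))"
        unfolding UN_iff by (intro bex_cong refl D_iff) simp
      also have "\<dots> \<longleftrightarrow> y \<in> ?L"
        using first_digit_less_iff[OF orb, of y w] by (auto simp: survivors_Suc)
      finally show "y \<in> ?L \<longleftrightarrow> y \<in> ?R" ..
    qed
    moreover have "?\<mu> (\<Union>k\<in>{m..<w}. ?D k) = (\<Sum>k\<in>{m..<w}. ?\<mu> (?D k))"
    proof (rule finite_measure_finite_Union)
      show "?D ` {m..<w} \<subseteq> sets (theta_gauss_measure \<theta>)" using sts Qm by auto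
      show "disjoint_family_on ?D {m..<w}"
        unfolding disjoint_family_on_def
      proof (intro ballI impI)
        fix k l assume kl: "k \<in> {m..<w}" "l \<in> {m..<w}" "k \<noteq> l"
        show "?D k \<inter> ?D l = {}"
        proof (rule equals0I)
          fix y assume "y \<in> ?D k \<inter> ?D l"
          then have "y \<in> ?D k" "y \<in> ?D l" by blast+
          then have "int k = int l" using D_iff[of k y] D_iff[of l y] kl by simp
          then show False using kl by simp
        qed
      qed
    qed simp
    moreover have "?\<mu> (?D k) = mass w n (branch k 0) - mass w n (branch k x)" if k: "k \<in> {m..<w}" for k
    proof -
      have k': "m \<le> k" using k by simp
      have "branch k x \<le> branch k 0" using Suc.prems k' by (intro branch_antimono) auto
      then have "?\<mu> (?D k) = ?\<mu> {y \<in> survivors w n. ?T y \<le> branch k 0} - ?\<mu> {y \<in> survivors w n. Q k (?T y)}"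
        using Qs(1)[OF k'] by (intro finite_measure_Diff sts Qm k') force
      then show ?thesis using Q\<mu>[OF k'] Suc.IH[OF branch_in[OF k', of 0]] by simp
    qed
    ultimately show ?thesis by simp
  qed
  have x: "0 \<le> x" "x \<le> \<theta>" using Suc.prems by auto
  have strict: "?\<mu> {y \<in> survivors w (Suc n). theta_map \<theta> (?T y) < x} = mass w (Suc n) x"
  proof (rule decomp[where Q = "\<lambda>k u. u \<le> branch k x"])
    fix k assume k: "m \<le> k"
    show "?\<mu> {y \<in> survivors w n. ?T y \<le> branch k x} = mass w n (branch k x)"
      using Suc.IH[OF branch_in[OF k x(1)]] by simp
    show "0 \<le> branch k x" using branch_pos[OF k x(1)] by simp
    fix u assume "0 < u" "u \<le> \<theta>"
    then show "\<lfloor>1 / (u * \<theta>)\<rfloor> = int k \<and> theta_map \<theta> u < x \<longleftrightarrow> \<not> u \<le> branch k x \<and> u \<le> branch k 0"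
      using branch_interval_iff(1)[of u k x] k x by auto
  qed (use sts in auto)
  have "?\<mu> {y \<in> survivors w (Suc n). theta_map \<theta> (?T y) \<le> x} = mass w (Suc n) x"
  proof (cases "x = \<theta>")
    case True
    have "theta_map \<theta> (?T y) < \<theta>" if "y \<in> survivors w (Suc n)" for y
      using theta_map_in[OF orb, of y] that by (simp add: survivors_Suc)
    then have "{y \<in> survivors w (Suc n). theta_map \<theta> (?T y) \<le> x} = {y \<in> survivors w (Suc n). theta_map \<theta> (?T y) < x}"
      using True by force
    then show ?thesis using strict by simp
  next
    case False
    then have xl: "x < \<theta>" using x by simp
    show ?thesis
    proof (rule decomp[where Q = "\<lambda>k u. u < branch k x"])
      fix k assume k: "m \<le> k"
      show "?\<mu> {y \<in> survivors w n. ?T y < branch k x} = mass w n (branch k x)"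
        using Suc.IH[OF branch_in[OF k x(1)]] by simp
      show "0 < branch k x" using branch_pos[OF k x(1)] by simp
      fix u assume "0 < u" "u \<le> \<theta>"
      then show "\<lfloor>1 / (u * \<theta>)\<rfloor> = int k \<and> theta_map \<theta> u \<le> x \<longleftrightarrow> \<not> u < branch k x \<and> u \<le> branch k 0"
        using branch_interval_iff(2)[of u k x] k x xl by auto
    qed (use sts in auto)
  qed
  then show ?case using strict by simp
qed

lemma measure_survivors: "measure (theta_gauss_measure \<theta>) (survivors w n) = mass w n \<theta>"
proof -
  have "(theta_map \<theta> ^^ n) y \<le> \<theta>" if "y \<in> survivors w n" for y
    using orbit_survivors[OF that, of n] by simp
  then have "{y \<in> survivors w n. (theta_map \<theta> ^^ n) y \<le> \<theta>} = survivors w n" by auto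
  then show ?thesis using measure_survivors_below[of \<theta> w n] theta_pos by simp
qed

text \<open>
  Digits are integers or infinite, so the real threshold may be replaced by its ceiling.
\<close>
lemma max_digit_event:
  assumes "N \<ge> 1" "W > 0"
  shows "{x \<in> theta_Omega \<theta>. ereal_of_enat (theta_max_digit \<theta> N x) < ereal W} = survivors (nat \<lceil>W\<rceil>) N"
proof -
  have "ereal_of_enat d < ereal W \<longleftrightarrow> d < enat (nat \<lceil>W\<rceil>)" for d
  proof (cases d)
    case (enat j)
    have "real j < W \<longleftrightarrow> j < nat \<lceil>W\<rceil>"
      by (simp add: zless_nat_eq_int_zless less_ceiling_iff)
    then show ?thesis by (simp add: enat)
  qed simp
  then show ?thesis using assms(1) by (auto simp: survivors_def theta_max_digit_def)
qed

end

theorem theorem4p6: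
  fixes m :: nat and \<theta> \<delta> :: real
  assumes "m \<ge> 1" and "\<theta> = 1 / sqrt (real m)"
    and "0 < \<delta>" and "\<delta> < 1"
  shows "\<exists>C>0. \<forall>y>0. \<forall>N::nat. N \<ge> 1 \<longrightarrow>
    \<bar>measure (theta_gauss_measure \<theta>)
        {x \<in> theta_Omega \<theta>.
          ereal_of_enat (theta_max_digit \<theta> N x) < ereal (real N * y / ln (1 + \<theta>\<^sup>2))}
      - exp (- (1 / y))\<bar>
    \<le> C * exp (- (ln (real N) powr \<delta>))"
proof -
  interpret theta_expansion m \<theta> using assms by unfold_locales
  \<comment> \<open>The factor \<open>exp 1\<close> comes from \<open>ln N powr \<delta> \<le> 1 + ln N\<close>.\<close>
  show ?thesis
  proof (intro exI[of _ "136 * exp 1"] conjI allI impI)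
    fix y :: real and N :: nat assume y: "y > 0" and N: "N \<ge> 1"
    have "real N * y / ln (1 + \<theta>\<^sup>2) > 0" using y N ln_norm_pos by simp
    note event = max_digit_event[OF N this]
    show "\<bar>measure (theta_gauss_measure \<theta>)
        {x \<in> theta_Omega \<theta>.
          ereal_of_enat (theta_max_digit \<theta> N x) < ereal (real N * y / ln (1 + \<theta>\<^sup>2))}
      - exp (- (1 / y))\<bar> \<le> 136 * exp 1 * exp (- (ln (real N) powr \<delta>))"
      unfolding event measure_survivors
      using mass_frechet_limit[OF y N] inverse_le_subexp[OF N assms(3,4)] by simp
  qed simp
qed

end
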